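(* Let $\lambda,\mu,\nu\in\mathbb{R}$ be pairwise distinct. Here $\operatorname{diag}(\cdot)$ denotes the block diagonal matrix with the listed blocks. 1. The set $\{\lambda\mathbb{I}_7\}$ is a cross-section for $\mathrm{Sym}_{\{(\lambda,7)\}}/\mathcal{G}_2$. 2. The set $\{\operatorname{diag}(\lambda,\mu\mathbb{I}_6)\}$ is a cross-section for $\mathrm{Sym}_{\{(\lambda,1),(\mu,6)\}}/\mathcal{G}_2$. 3. The set $\{\operatorname{diag}(\lambda\mathbb{I}_2,\mu\mathbb{I}_5)\}$ is a cross-section for $\mathrm{Sym}_{\{(\lambda,2),(\mu,5)\}}/\mathcal{G}_2$. 4. The set $\{\operatorname{diag}(\lambda,\mu,\nu\mathbb{I}_5)\}$ is a cross-section for $\mathrm{Sym}_{\{(\lambda,1),(\mu,1),(\nu,5)\}}/\mathcal{G}_2$.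
   Context: Let $V$ be a 7-dimensional Euclidean space with a vector product $\pi$, i.e. a linear map $\pi:V\wedge V\to V$ such that $\{u,v,\pi(u\wedge v)\}$ is orthonormal whenever $\{u,v\}\subset V$ is. Write $xy=\pi(x\wedge y)$. Let $\mathcal{G}_2=\mathrm{Aut}(\pi)$ be the group of all orthogonal linear maps $g:V\to V$ with $g(xy)=g(x)g(y)$ for all $x,y\in V$. A Cayley triple is a triple $(u,v,z)\in V^3$ such that $\{u,v,uv,z\}$ is orthonormal; it determines an orthonormal basis $(u,v,uv,z,uz,vz,(uv)z)$ of $V$. Fix a Cayley triple $s$, and for a symmetric endomorphism $\delta$ of $V$ let $[\delta]_s$ be its matrix in the basis determined by $s$; $\delta\mapsto[\delta]_s$ is a bijection $\mathrm{Sym}(V)\to\mathrm{Sym}(\mathbb{R}^7)$ from symmetric endomorphisms of $V$ to real symmetric $7\times7$-matrices. $\mathcal{G}_2$ acts on $\mathrm{Sym}(\mathbb{R}^7)$ by $[\delta]_s\cdot g=[g^{-1}\delta g]_s$. For a symmetric matrix $\delta$ let $\mathfrak{p}(\delta)=\{(\lambda,\dim\mathcal{E}_\lambda(\delta))\mid\lambda\text{ an eigenvalue of }\delta\}$, where $\mathcal{E}_\lambda(\delta)$ is the eigenspace of $\lambda$, and for a set $\mathfrak{p}$ of such pairs let $\mathrm{Sym}_{\mathfrak{p}}=\{\delta\in\mathrm{Sym}(\mathbb{R}^7)\mid\mathfrak{p}(\delta)=\mathfrak{p}\}$, which is invariant under the action. A cross-section for $\mathrm{Sym}_{\mathfrak{p}}/\mathcal{G}_2$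 is a subset of $\mathrm{Sym}_{\mathfrak{p}}$ containing exactly one element of each $\mathcal{G}_2$-orbit. $\mathbb{I}_n$ is the $n\times n$ identity matrix. *)

theory Defs
  imports "HOL-Analysis.Analysis"
begin

text \<open>
  Orthonormality is a property of families, not of sets: an orthonormal pair consists of two
  different vectors. Families are given as lists.
\<close>

definition orthonormal :: "'a::real_inner list \<Rightarrow> bool" where
  "orthonormal xs \<longleftrightarrow>
     (\<forall>i<length xs. \<forall>j<length xs. xs ! i \<bullet> xs ! j = (if i = j then 1 else 0))"

text \<open>
  A linear map on the exterior square of \<open>V\<close> is the same thing as an alternating bilinear map on
  \<open>V\<close>; below, \<open>p x y\<close> is the value at \<open>x \<and> y\<close>, that is, the product \<open>xy\<close>.
\<close>

definition vector_product :: "('a::euclidean_space \<Rightarrow> 'a \<Rightarrow> 'a) \<Rightarrow> bool" where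
  "vector_product p \<longleftrightarrow>
     bilinear p \<and> (\<forall>x. p x x = 0) \<and>
     (\<forall>u v. orthonormal [u, v] \<longrightarrow> orthonormal [u, v, p u v])"

definition G2 :: "('a::euclidean_space \<Rightarrow> 'a \<Rightarrow> 'a) \<Rightarrow> ('a \<Rightarrow> 'a) set" where
  "G2 p = {g. orthogonal_transformation g \<and> (\<forall>x y. g (p x y) = p (g x) (g y))}"

definition Cayley_triple ::
    "('a::euclidean_space \<Rightarrow> 'a \<Rightarrow> 'a) \<Rightarrow> 'a \<times> 'a \<times> 'a \<Rightarrow> bool" where
  "Cayley_triple p s \<longleftrightarrow> (case s of (u, v, z) \<Rightarrow> orthonormal [u, v, p u v, z])"

text \<open>
  The index type \<^typ>\<open>7\<close> consists of the residues modulo 7; \<^const>\<open>vector\<close> places the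
  entries of a list of length 7 at the indices \<open>1, 2, \<dots>, 7\<close>, the last of which equals \<open>0\<close>.
\<close>

lemma vector_7:
  "(vector [a1, a2, a3, a4, a5, a6, a7] :: 'a::zero ^ 7) $ 1 = a1"
  "(vector [a1, a2, a3, a4, a5, a6, a7] :: 'a::zero ^ 7) $ 2 = a2"
  "(vector [a1, a2, a3, a4, a5, a6, a7] :: 'a::zero ^ 7) $ 3 = a3"
  "(vector [a1, a2, a3, a4, a5, a6, a7] :: 'a::zero ^ 7) $ 4 = a4"
  "(vector [a1, a2, a3, a4, a5, a6, a7] :: 'a::zero ^ 7) $ 5 = a5"
  "(vector [a1, a2, a3, a4, a5, a6, a7] :: 'a::zero ^ 7) $ 6 = a6"
  "(vector [a1, a2, a3, a4, a5, a6, a7] :: 'a::zero ^ 7) $ 7 = a7"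
  unfolding vector_def by simp_all

definition Cayley_basis ::
    "('a::euclidean_space \<Rightarrow> 'a \<Rightarrow> 'a) \<Rightarrow> 'a \<times> 'a \<times> 'a \<Rightarrow> 'a ^ 7" where
  "Cayley_basis p s =
     (case s of (u, v, z) \<Rightarrow> vector [u, v, p u v, z, p u z, p v z, p (p u v) z])"

text \<open>The \<open>j\<close>-th column consists of the coordinates of the image of the \<open>j\<close>-th basis vector.\<close>

definition matrix_wrt :: "'a::euclidean_space ^ 7 \<Rightarrow> ('a \<Rightarrow> 'a) \<Rightarrow> real ^ 7 ^ 7" where
  "matrix_wrt b d = (\<chi> i j. representation (range (($) b)) (d (b $ j)) (b $ i))"

definition symmetric_endos :: "('a::euclidean_space \<Rightarrow> 'a) set" where
  "symmetric_endos = {d. linear d \<and> (\<forall>x y. d x \<bullet> y = x \<bullet> d y)}"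

text \<open>
  \<open>G2_act p s A g\<close> is \<open>A \<cdot> g\<close>: the matrix of \<open>g\<inverse> d g\<close>, where \<open>d\<close> is the symmetric
  endomorphism with matrix \<open>A\<close>.
\<close>

definition G2_act ::
    "('a::euclidean_space \<Rightarrow> 'a \<Rightarrow> 'a) \<Rightarrow> 'a \<times> 'a \<times> 'a \<Rightarrow> real ^ 7 ^ 7 \<Rightarrow> ('a \<Rightarrow> 'a) \<Rightarrow> real ^ 7 ^ 7" where
  "G2_act p s A g =
     (let m = matrix_wrt (Cayley_basis p s)
      in m (inv g \<circ> inv_into symmetric_endos m A \<circ> g))"

definition G2_orbit ::
    "('a::euclidean_space \<Rightarrow> 'a \<Rightarrow> 'a) \<Rightarrow> 'a \<times> 'a \<times> 'a \<Rightarrow> real ^ 7 ^ 7 \<Rightarrow> (real ^ 7 ^ 7) set" where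
  "G2_orbit p s A = G2_act p s A ` G2 p"

definition eigenspace :: "real ^ 'n ^ 'n \<Rightarrow> real \<Rightarrow> (real ^ 'n) set" where
  "eigenspace A l = {x. A *v x = l *\<^sub>R x}"

definition eigenvalue :: "real ^ 'n ^ 'n \<Rightarrow> real \<Rightarrow> bool" where
  "eigenvalue A l \<longleftrightarrow> (\<exists>x. x \<noteq> 0 \<and> A *v x = l *\<^sub>R x)"

definition eigenpairs :: "real ^ 'n ^ 'n \<Rightarrow> (real \<times> nat) set" where
  "eigenpairs A = {(l, dim (eigenspace A l)) | l. eigenvalue A l}"

definition Sym :: "(real \<times> nat) set \<Rightarrow> (real ^ 7 ^ 7) set" where
  "Sym P = {A. transpose A = A \<and> eigenpairs A = P}"

definition cross_section ::
    "('a::euclidean_space \<Rightarrow> 'a \<Rightarrow> 'a) \<Rightarrow> 'a \<times> 'a \<times> 'a \<Rightarrow> (real \<times> nat) set \<Rightarrow> (real ^ 7 ^ 7) set \<Rightarrow> bool" where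
  "cross_section p s P C \<longleftrightarrow>
     C \<subseteq> Sym P \<and> (\<forall>orb \<in> G2_orbit p s ` Sym P. \<exists>!A. A \<in> C \<and> A \<in> orb)"

text \<open>
  \<open>block_diag [(c\<^sub>1, n\<^sub>1), \<dots>, (c\<^sub>k, n\<^sub>k)]\<close>, with \<open>n\<^sub>1 + \<dots> + n\<^sub>k = 7\<close>, is the block diagonal matrix
  whose \<open>i\<close>-th block is \<open>c\<^sub>i\<close> times the identity matrix of size \<open>n\<^sub>i\<close>.
\<close>

definition block_diag :: "(real \<times> nat) list \<Rightarrow> real ^ 7 ^ 7" where
  "block_diag bs =
     (\<chi> i j. if i = j then vector (concat (map (\<lambda>(c, n). replicate n c) bs)) $ i else 0)"

end

theory Submission
  imports Defs
begin

text \<open>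
  The automorphism group of a vector product on a 7-dimensional space acts transitively on Cayley
  triples (\<open>G2_transitive\<close>): polarising the defining property determines all products of vectors of
  a Cayley basis, and the resulting table (\<open>Cayley_table\<close>) is the same for every triple. Hence an
  endomorphism has a given diagonal matrix in its orbit as soon as some Cayley basis consists of
  eigenvectors with the prescribed eigenvalues in the prescribed order (\<open>diagonal_in_orbit\<close>).

  A Cayley triple \<open>(u, v, z)\<close> may begin with any orthonormal pair \<open>u, v\<close>. In all four parts, the last
  five diagonal entries of the listed matrix agree. If \<open>u\<close> and \<open>v\<close> are eigenvectors to the first
  two entries, then the other basis vectors are orthogonal to them and hence, since the
  multiplicities add up to 7, lie in the eigenspace of the common last entry
  (\<open>orthogonal_to_other_eigenvectors\<close>). So the singleton of such a diagonal matrix is always a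
  cross-section (\<open>cross_section_diagonal\<close>), and the four parts differ only in the
  multiplicities of the diagonal entries.
\<close>

section \<open>The index type with seven elements\<close>

lemma exhaust_7:
  fixes x :: 7
  shows "x = 1 \<or> x = 2 \<or> x = 3 \<or> x = 4 \<or> x = 5 \<or> x = 6 \<or> x = 7"
proof (induct x)
  case (of_int z)
  \<comment> \<open>The residue 0 is the one that the numeral 7 denotes.\<close>
  then have "z = 0 \<or> z = 1 \<or> z = 2 \<or> z = 3 \<or> z = 4 \<or> z = 5 \<or> z = 6" by fastforce
  then show ?case by auto
qed

lemma UNIV_7: "UNIV = {1, 2, 3, 4, 5, 6, 7 :: 7}"
  using exhaust_7 by auto

lemma forall_7: "(\<forall>i::7. P i) \<longleftrightarrow> P 1 \<and> P 2 \<and> P 3 \<and> P 4 \<and> P 5 \<and> P 6 \<and> P 7"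
  by (metis exhaust_7)

lemma sum_7: "sum f (UNIV :: 7 set) = f 1 + f 2 + f 3 + f 4 + f 5 + f 6 + f 7"
  unfolding UNIV_7 by (simp add: ac_simps)

lemma card_7: "card {i::7. P i} = of_bool (P 1) + of_bool (P 2) + of_bool (P 3) + of_bool (P 4)
    + of_bool (P 5) + of_bool (P 6) + of_bool (P 7)"
proof -
  have "card {i::7. P i} = (\<Sum>i\<in>UNIV. if P i then 1 else 0)"
    by (simp add: sum.If_cases)
  then show ?thesis by (simp only: sum_7 of_bool_def)
qed

section \<open>Orthonormal lists\<close>

lemma orthonormal_snoc:
  "orthonormal (xs @ [z]) \<longleftrightarrow> orthonormal xs \<and> z \<bullet> z = 1 \<and> (\<forall>x\<in>set xs. x \<bullet> z = 0)"
  by (auto simp: orthonormal_def nth_append less_Suc_eq all_set_conv_all_nth inner_commute)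

lemma orthonormal_Nil: "orthonormal []"
  by (simp add: orthonormal_def)

lemma orthonormal_single: "orthonormal [z] \<longleftrightarrow> z \<bullet> z = 1"
  using orthonormal_snoc[of "[]" z] by (simp add: orthonormal_Nil)

lemma orthonormal_pair: "orthonormal [x, y] \<longleftrightarrow> x \<bullet> x = 1 \<and> y \<bullet> y = 1 \<and> x \<bullet> y = 0"
  using orthonormal_snoc[of "[x]" y] by (auto simp: orthonormal_single)

lemma orthonormal_triple: "orthonormal [x, y, z] \<longleftrightarrow>
    orthonormal [x, y] \<and> z \<bullet> z = 1 \<and> x \<bullet> z = 0 \<and> y \<bullet> z = 0"
  using orthonormal_snoc[of "[x, y]" z] by auto

lemma orthonormal_independent:
  assumes "orthonormal xs"
  shows "independent (set xs)" and "card (set xs) = length xs"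
proof -
  have "\<forall>x\<in>set xs. \<forall>y\<in>set xs. x \<noteq> y \<longrightarrow> x \<bullet> y = 0" "\<forall>x\<in>set xs. x \<bullet> x = 1"
    using assms unfolding orthonormal_def by (auto simp: in_set_conv_nth)
  then show "independent (set xs)"
    by (intro pairwise_orthogonal_independent) (auto simp: pairwise_def orthogonal_def)
  have "xs ! i \<noteq> xs ! j" if "i < length xs" "j < length xs" "i \<noteq> j" for i j
  proof
    assume "xs ! i = xs ! j"
    then have "xs ! i \<bullet> xs ! j = 1" using assms that unfolding orthonormal_def by auto
    then show False using assms that unfolding orthonormal_def by auto
  qed
  then have "distinct xs" by (simp add: distinct_conv_nth)
  then show "card (set xs) = length xs" by (rule distinct_card)
qed

lemma orthonormal_extend:
  fixes xs :: "'a::euclidean_space list"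
  assumes "orthonormal xs" and "length xs < DIM('a)"
  obtains z where "orthonormal (xs @ [z])"
proof -
  have "dim (set xs) < DIM('a)"
    using orthonormal_independent[OF assms(1)] assms(2) by (simp add: dim_eq_card_independent)
  then obtain y where y: "y \<noteq> 0" "\<And>x. x \<in> span (set xs) \<Longrightarrow> orthogonal y x"
    by (rule orthogonal_to_subspace_exists) blast
  have "(y /\<^sub>R norm y) \<bullet> (y /\<^sub>R norm y) = 1"
    using y(1) by (simp add: dot_square_norm power2_eq_square field_simps)
  moreover have "x \<bullet> (y /\<^sub>R norm y) = 0" if "x \<in> set xs" for x
    using y(2)[of x] that by (simp add: span_base orthogonal_def inner_commute)
  ultimately show ?thesis using assms(1) that[of "y /\<^sub>R norm y"] by (simp add: orthonormal_snoc)
qed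

text \<open>
  Applied to an eigenspace, this turns a multiplicity into that many orthonormal eigenvectors.
\<close>

lemma orthonormal_in_subspace:
  fixes S :: "'a::euclidean_space set"
  assumes "subspace S"
  obtains xs where "orthonormal xs" "set xs \<subseteq> S" "length xs = dim S"
proof -
  obtain B where B: "B \<subseteq> S" "pairwise orthogonal B" "\<And>x. x \<in> B \<Longrightarrow> norm x = 1"
    "independent B" "card B = dim S"
    using orthonormal_basis_subspace[OF assms] by metis
  obtain xs where xs: "set xs = B" "distinct xs"
    using finite_distinct_list[OF independent_imp_finite[OF B(4)]] by blast
  have "orthonormal xs"
    unfolding orthonormal_def
  proof (intro allI impI)
    fix i j assume ij: "i < length xs" "j < length xs"
    then have "xs ! i \<in> B" "xs ! j \<in> B" using xs by auto
    then show "xs ! i \<bullet> xs ! j = (if i = j then 1 else 0)"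
      using B(2,3) xs ij
      by (auto simp: pairwise_def orthogonal_def dot_square_norm nth_eq_iff_index_eq)
  qed
  then show ?thesis using that B xs distinct_card by metis
qed

section \<open>Coordinates in an orthonormal frame\<close>

text \<open>
  The counterpart of \<^const>\<open>orthonormal\<close> for families indexed by a finite type, which is the form
  in which \<^const>\<open>Cayley_basis\<close> delivers the basis of a Cayley triple.
\<close>

definition orthonormal_frame :: "'a::real_inner ^ 'n \<Rightarrow> bool" where
  "orthonormal_frame b \<longleftrightarrow> (\<forall>i j. b $ i \<bullet> b $ j = (if i = j then 1 else 0))"

lemma orthonormal_frameD:
  "orthonormal_frame b \<Longrightarrow> b $ i \<bullet> b $ j = (if i = j then 1 else 0)"
  by (simp add: orthonormal_frame_def)

lemma orthonormal_frame_inj: "orthonormal_frame b \<Longrightarrow> inj (($) b)"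
  unfolding orthonormal_frame_def inj_def by (metis zero_neq_one)

lemma orthonormal_frame_independent:
  fixes b :: "'a::euclidean_space ^ 'n"
  assumes "orthonormal_frame b"
  shows "independent (range (($) b))"
proof (rule pairwise_orthogonal_independent)
  show "pairwise orthogonal (range (($) b))"
    by (auto simp: pairwise_def orthogonal_def orthonormal_frameD[OF assms])
  show "0 \<notin> range (($) b)"
    using orthonormal_frameD[OF assms] by (metis imageE inner_zero_left zero_neq_one)
qed

lemma orthonormal_frame_span:
  fixes b :: "'a::euclidean_space ^ 'n"
  assumes "orthonormal_frame b" "CARD('n) = DIM('a)"
  shows "span (range (($) b)) = UNIV"
proof -
  have "card (range (($) b)) = DIM('a)"
    using orthonormal_frame_inj[OF assms(1)] assms(2) by (simp add: card_image)
  then show ?thesis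
    using orthonormal_frame_independent[OF assms(1)]
    by (metis dim_eq_card_independent dim_eq_full)
qed

lemma orthonormal_frame_combination_inner:
  assumes "orthonormal_frame b"
  shows "(\<Sum>i\<in>UNIV. f i *\<^sub>R b $ i) \<bullet> b $ j = f j"
  by (simp add: inner_sum_left orthonormal_frameD[OF assms] if_distrib cong: if_cong)

lemma orthonormal_frame_eqI:
  fixes b :: "'a::euclidean_space ^ 'n"
  assumes b: "orthonormal_frame b" "CARD('n) = DIM('a)"
    and eq: "\<And>i. x \<bullet> b $ i = y \<bullet> b $ i"
  shows "x = y"
proof -
  have "orthogonal (x - y) z" for z
    by (rule orthogonal_to_span[of z "range (($) b)"])
      (auto simp: orthonormal_frame_span[OF b] orthogonal_def inner_diff_left eq)
  then have "orthogonal (x - y) (x - y)" .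
  then show ?thesis by (simp add: orthogonal_def)
qed

lemma orthonormal_frame_expansion:
  fixes b :: "'a::euclidean_space ^ 'n"
  assumes b: "orthonormal_frame b" "CARD('n) = DIM('a)"
  shows "(\<Sum>i\<in>UNIV. (x \<bullet> b $ i) *\<^sub>R b $ i) = x"
  by (rule orthonormal_frame_eqI[OF b]) (simp add: orthonormal_frame_combination_inner[OF b(1)])

lemma representation_orthonormal_frame:
  fixes b :: "'a::euclidean_space ^ 'n"
  assumes b: "orthonormal_frame b" "CARD('n) = DIM('a)"
  shows "representation (range (($) b)) x (b $ i) = x \<bullet> b $ i"
proof -
  let ?r = "representation (range (($) b)) x"
  have "x = (\<Sum>v\<in>range (($) b). ?r v *\<^sub>R v)"
    using sum_representation_eq[of "range (($) b)" x "range (($) b)"]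
      orthonormal_frame_independent[OF b(1)] orthonormal_frame_span[OF b] by simp
  also have "\<dots> = (\<Sum>j\<in>UNIV. ?r (b $ j) *\<^sub>R b $ j)"
    by (simp add: sum.reindex orthonormal_frame_inj[OF b(1)])
  finally have "x = (\<Sum>j\<in>UNIV. ?r (b $ j) *\<^sub>R b $ j)" .
  then show ?thesis
    using orthonormal_frame_combination_inner[OF b(1), of "\<lambda>j. ?r (b $ j)" i] by simp
qed

text \<open>
  Since the coordinates in an orthonormal basis are inner products, the matrix entries become inner
  products too, and the abstract \<^const>\<open>representation\<close> disappears from all later arguments.
\<close>

lemma matrix_wrt_inner:
  fixes b :: "'a::euclidean_space ^ 7"
  assumes "orthonormal_frame b" "DIM('a) = 7"
  shows "matrix_wrt b d $ i $ j = d (b $ j) \<bullet> b $ i"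
  using representation_orthonormal_frame[OF assms(1)] assms(2) by (simp add: matrix_wrt_def)

section \<open>Symmetric endomorphisms and their eigenspaces\<close>

lemma subspace_eigenvectors:
  assumes "linear d"
  shows "subspace {y. d y = c *\<^sub>R y}"
  using assms by (auto simp: subspace_def linear_0 linear_add linear_scale algebra_simps)

lemma eigenvectors_orthogonal:
  assumes "d \<in> symmetric_endos" "d x = a *\<^sub>R x" "d y = b *\<^sub>R y" "a \<noteq> b"
  shows "x \<bullet> y = 0"
proof -
  have "a * (x \<bullet> y) = d x \<bullet> y" using assms(2) by simp
  also have "\<dots> = x \<bullet> d y" using assms(1) by (simp add: symmetric_endos_def)
  also have "\<dots> = b * (x \<bullet> y)" using assms(3) by simp
  finally show ?thesis using assms(4) by simp
qed

text \<open>
  Eigenvectors of a symmetric map to different eigenvalues are orthogonal, so the eigenspace of \<open>c\<close>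
  lies in the orthogonal complement of \<open>X\<close>. The hypothesis on dimensions says that the complement
  has the same dimension, hence the two subspaces agree. This stands in for the spectral theorem:
  the multiplicities already add up to the dimension of the space.
\<close>

lemma orthogonal_to_other_eigenvectors:
  fixes d :: "'a::euclidean_space \<Rightarrow> 'a"
  assumes d: "d \<in> symmetric_endos" and X: "independent X"
    and other: "\<And>x. x \<in> X \<Longrightarrow> \<exists>a. a \<noteq> c \<and> d x = a *\<^sub>R x"
    and dims: "card X + dim {y. d y = c *\<^sub>R y} = DIM('a)"
    and y: "\<And>x. x \<in> X \<Longrightarrow> x \<bullet> y = 0"
  shows "d y = c *\<^sub>R y"
proof -
  let ?E = "{y. d y = c *\<^sub>R y}"
  let ?S = "{y. \<forall>x\<in>span X. orthogonal x y}"
  have lin: "linear d" using d by (simp add: symmetric_endos_def)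
  have S: "y \<in> ?S" if "\<And>x. x \<in> X \<Longrightarrow> x \<bullet> y = 0" for y
    using orthogonal_to_span[of _ X y] that
    by (auto simp: orthogonal_def inner_commute)
  have "?E \<subseteq> ?S"
  proof
    fix y assume "y \<in> ?E"
    then have "x \<bullet> y = 0" if "x \<in> X" for x
      using eigenvectors_orthogonal[OF d] other[OF that] by blast
    then show "y \<in> ?S" by (rule S)
  qed
  moreover have "dim ?S + dim (span X) = DIM('a)"
    using dim_subspace_orthogonal_to_vectors[of "span X" UNIV] by simp
  moreover have "dim (span X) = card X"
    using X by (simp add: dim_eq_card_independent)
  moreover have "subspace ?S"
    by (auto simp: subspace_def orthogonal_clauses)
  ultimately have "?E = ?S"
    using dims subspace_eigenvectors[OF lin] by (intro subspace_dim_equal) auto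
  then show ?thesis using S[of y] y by blast
qed

text \<open>
  Because of this, the endomorphism that \<^const>\<open>inv_into\<close> selects in \<^const>\<open>G2_act\<close> is symmetric
  and has the given matrix.
\<close>

lemma symmetric_endo_exists:
  fixes b :: "'a::euclidean_space ^ 7"
  assumes b: "orthonormal_frame b" "DIM('a) = 7" and A: "transpose A = A"
  shows "A \<in> matrix_wrt b ` symmetric_endos"
proof
  define f where "f i x = (\<Sum>j\<in>UNIV. A $ i $ j * (x \<bullet> b $ j))" for i x
  let ?d = "\<lambda>x. \<Sum>i\<in>UNIV. f i x *\<^sub>R b $ i"
  have "f i (x + y) = f i x + f i y" "f i (c *\<^sub>R x) = c * f i x" for i x y c
    by (simp_all add: f_def inner_add_left distrib_left sum.distrib sum_distrib_left mult.left_commute)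
  then have "linear ?d"
    by (intro linearI) (simp_all add: scaleR_add_left sum.distrib scaleR_sum_right)
  moreover have "?d x \<bullet> y = x \<bullet> ?d y" for x y
  proof -
    have sym: "A $ i $ j = A $ j $ i" for i j
      using arg_cong[OF A, of "\<lambda>M. M $ i $ j"] by (simp add: transpose_def)
    have "?d x \<bullet> y = (\<Sum>i\<in>UNIV. \<Sum>j\<in>UNIV. A $ i $ j * (x \<bullet> b $ j) * (b $ i \<bullet> y))"
      by (simp add: f_def inner_sum_left sum_distrib_right)
    also have "\<dots> = (\<Sum>j\<in>UNIV. \<Sum>i\<in>UNIV. A $ i $ j * (x \<bullet> b $ j) * (b $ i \<bullet> y))"
      by (rule sum.swap)
    also have "\<dots> = (\<Sum>j\<in>UNIV. \<Sum>i\<in>UNIV. A $ j $ i * (y \<bullet> b $ i) * (x \<bullet> b $ j))"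
      by (intro sum.cong refl) (simp add: sym inner_commute)
    also have "\<dots> = x \<bullet> ?d y"
      by (simp add: f_def inner_sum_right sum_distrib_right)
    finally show ?thesis .
  qed
  ultimately show "?d \<in> symmetric_endos" by (simp add: symmetric_endos_def)
  have "f i (b $ j) = A $ i $ j" for i j
    by (simp add: f_def orthonormal_frameD[OF b(1)] if_distrib cong: if_cong)
  then show "A = matrix_wrt b ?d"
    by (simp add: vec_eq_iff matrix_wrt_inner[OF b] orthonormal_frame_combination_inner[OF b(1)])
qed

text \<open>
  The coordinate map of an orthonormal frame is a linear isomorphism that carries the eigenspaces of
  an endomorphism to those of its matrix, so the multiplicities agree.
\<close>

lemma dim_eigenspace_matrix_wrt:
  fixes b :: "'a::euclidean_space ^ 7"
  assumes b: "orthonormal_frame b" "DIM('a) = 7" and d: "linear d"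
  shows "dim (eigenspace (matrix_wrt b d) c) = dim {y. d y = c *\<^sub>R y}"
proof -
  let ?A = "matrix_wrt b d"
  define T where "T x = (\<chi> i. x \<bullet> b $ i)" for x
  have b7: "CARD(7) = DIM('a)" using b(2) by simp
  have lin: "linear T"
    by (intro linearI) (simp_all add: T_def vec_eq_iff inner_add_left)
  have inj: "inj T"
    by (rule injI, rule orthonormal_frame_eqI[OF b(1) b7]) (simp add: T_def vec_eq_iff)
  have surj: "T (\<Sum>i\<in>UNIV. y $ i *\<^sub>R b $ i) = y" for y
    by (simp add: T_def vec_eq_iff orthonormal_frame_combination_inner[OF b(1)])
  have Td: "T (d x) = ?A *v T x" for x
  proof -
    have "d x = d (\<Sum>j\<in>UNIV. (x \<bullet> b $ j) *\<^sub>R b $ j)"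
      by (simp add: orthonormal_frame_expansion[OF b(1) b7])
    also have "\<dots> = (\<Sum>j\<in>UNIV. (x \<bullet> b $ j) *\<^sub>R d (b $ j))"
      by (simp add: linear_sum[OF d] linear_scale[OF d])
    finally show ?thesis
      by (simp add: T_def vec_eq_iff matrix_vector_mult_def matrix_wrt_inner[OF b]
          inner_sum_left mult.commute)
  qed
  have "eigenspace ?A c = T ` {y. d y = c *\<^sub>R y}"
  proof (intro set_eqI iffI)
    fix y assume y: "y \<in> eigenspace ?A c"
    define x where "x = (\<Sum>i\<in>UNIV. y $ i *\<^sub>R b $ i)"
    have x: "T x = y" by (simp add: x_def surj)
    have "T (d x) = T (c *\<^sub>R x)"
      using y by (simp add: Td x linear_scale[OF lin] eigenspace_def)
    then have "d x = c *\<^sub>R x" using inj by (simp add: inj_eq)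
    then show "y \<in> T ` {y. d y = c *\<^sub>R y}" using x by blast
  next
    fix y assume "y \<in> T ` {y. d y = c *\<^sub>R y}"
    then show "y \<in> eigenspace ?A c"
      by (auto simp: eigenspace_def Td[symmetric] linear_scale[OF lin])
  qed
  then show ?thesis
    using dim_image_eq[OF lin] inj by (metis inj_on_subset subset_UNIV)
qed

section \<open>Diagonal matrices\<close>

definition diagonal :: "real ^ 'n \<Rightarrow> real ^ 'n ^ 'n" where
  "diagonal d = (\<chi> i j. if i = j then d $ i else 0)"

lemma diagonal_mult_vector: "diagonal d *v x = (\<chi> i. d $ i * x $ i)"
  by (simp add: diagonal_def matrix_vector_mult_def vec_eq_iff if_distrib[where f="\<lambda>a. a * _"] cong: if_cong)

lemma eigenpairs_diagonal:
  "eigenpairs (diagonal d) = range (\<lambda>i. (d $ i, card {j. d $ j = d $ i}))"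
proof -
  have "eigenspace (diagonal d) c = {x. \<forall>i. i \<notin> {j. d $ j = c} \<longrightarrow> x $ i = 0}" for c
    by (auto simp: eigenspace_def diagonal_mult_vector vec_eq_iff)
  then have dim: "dim (eigenspace (diagonal d) c) = card {j. d $ j = c}" for c
    using dim_substandard_cart[of "{j. d $ j = c}", where 'a=real] by (simp add: dim_vec_eq)
  have "eigenvalue (diagonal d) c \<longleftrightarrow> c \<in> range (($) d)" for c
  proof
    assume "eigenvalue (diagonal d) c"
    then obtain x i where "diagonal d *v x = c *\<^sub>R x" "x $ i \<noteq> 0"
      unfolding eigenvalue_def by (metis vec_eq_iff zero_index)
    then have "d $ i * x $ i = c * x $ i"
      by (metis diagonal_mult_vector real_scaleR_def vec_lambda_beta vector_scaleR_component)
    then show "c \<in> range (($) d)" using \<open>x $ i \<noteq> 0\<close> by auto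
  next
    assume "c \<in> range (($) d)"
    then obtain i where i: "c = d $ i" by auto
    have "diagonal d *v axis i 1 = c *\<^sub>R axis i 1"
      by (simp add: diagonal_mult_vector vec_eq_iff axis_def i)
    then show "eigenvalue (diagonal d) c"
      unfolding eigenvalue_def by (metis axis_eq_0_iff zero_neq_one)
  qed
  then show ?thesis by (auto simp: eigenpairs_def dim)
qed

section \<open>Identities of a vector product\<close>

context
  fixes p :: "'a::euclidean_space \<Rightarrow> 'a \<Rightarrow> 'a"
  assumes vector_product: "vector_product p"
begin

lemma bilinear_p: "bilinear p"
  using vector_product by (simp add: vector_product_def)

lemma p_self [simp]: "p x x = 0"
  using vector_product by (simp add: vector_product_def)

lemmas p_add_left = bilinear_ladd[OF bilinear_p]
  and p_add_right = bilinear_radd[OF bilinear_p]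
  and p_diff_right = bilinear_rsub[OF bilinear_p]
  and p_scale_left = bilinear_lmul[OF bilinear_p]
  and p_scale_right = bilinear_rmul[OF bilinear_p]
  and p_minus_left = bilinear_lneg[OF bilinear_p]
  and p_minus_right = bilinear_rneg[OF bilinear_p]
  and p_zero_left = bilinear_lzero[OF bilinear_p]
  and p_zero_right = bilinear_rzero[OF bilinear_p]

lemma p_anticommute: "p y x = - p x y"
proof -
  have "p (x + y) (x + y) = p x y + p y x"
    by (simp add: p_add_left p_add_right del: p_self) (simp add: p_self)
  then show ?thesis by (simp add: eq_neg_iff_add_eq_0 add.commute)
qed

text \<open>
  The axiom only speaks of orthonormal pairs. The component of \<open>y\<close> along \<open>x\<close> contributes nothing to
  the product, and the remaining component and \<open>x\<close> can be normalised, so bilinearity extends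
  the axiom to arbitrary vectors.
\<close>

lemma p_orthogonal_left_and_norm:
  "p x y \<bullet> x = 0 \<and> p x y \<bullet> p x y = (x \<bullet> x) * (y \<bullet> y) - (x \<bullet> y)\<^sup>2"
proof (cases "x = 0")
  case True
  then show ?thesis by (simp add: p_zero_left)
next
  case False
  define w where "w = y - ((x \<bullet> y) / (x \<bullet> x)) *\<^sub>R x"
  have xw: "x \<bullet> w = 0" using False by (simp add: w_def inner_diff_right)
  have pw: "p x w = p x y" by (simp add: w_def p_diff_right p_scale_right)
  have ww: "(x \<bullet> x) * (w \<bullet> w) = (x \<bullet> x) * (y \<bullet> y) - (x \<bullet> y)\<^sup>2"
  proof -
    have "w \<bullet> w = y \<bullet> w" using xw by (subst (1) w_def) (simp add: inner_diff_left)
    also have "\<dots> = y \<bullet> y - (x \<bullet> y)\<^sup>2 / (x \<bullet> x)"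
      by (simp add: w_def inner_diff_right inner_commute[of y x] power2_eq_square)
    finally show ?thesis using False by (simp add: field_simps)
  qed
  show ?thesis
  proof (cases "w = 0")
    case True
    then show ?thesis using pw ww by (simp add: p_zero_right)
  next
    case w: False
    define u v where "u = x /\<^sub>R norm x" and "v = w /\<^sub>R norm w"
    have "orthonormal [u, v]"
      using False w xw by (simp add: orthonormal_pair u_def v_def dot_square_norm power2_eq_square)
    then have "orthonormal [u, v, p u v]"
      using vector_product by (simp add: vector_product_def)
    then have uv: "p u v \<bullet> p u v = 1" "u \<bullet> p u v = 0"
      by (simp_all add: orthonormal_triple)
    have x: "x = norm x *\<^sub>R u" and "w = norm w *\<^sub>R v"
      using False w by (simp_all add: u_def v_def)
    then have "p x w = (norm x * norm w) *\<^sub>R p u v"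
      by (metis p_scale_left p_scale_right scaleR_scaleR)
    then have pxy: "p x y = (norm x * norm w) *\<^sub>R p u v" using pw by simp
    have "p x y \<bullet> x = 0"
      by (subst x) (simp add: pxy inner_commute[of _ u] uv)
    moreover have "p x y \<bullet> p x y = (x \<bullet> x) * (w \<bullet> w)"
      using uv(1) by (simp add: pxy power2_norm_eq_inner[symmetric] power2_eq_square)
    ultimately show ?thesis using ww by simp
  qed
qed

lemma p_orthogonal_left: "p x y \<bullet> x = 0"
  using p_orthogonal_left_and_norm by blast

text \<open>
  Polarisation of \<open>p x y \<bullet> y = 0\<close> in \<open>y\<close>: left multiplication by \<open>x\<close> is skew-symmetric.
\<close>

lemma p_skew: "p x y \<bullet> z = - (y \<bullet> p x z)"
proof -
  have right: "p x y \<bullet> y = 0" for y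
    using p_orthogonal_left[of y x] by (simp add: p_anticommute[of x y])
  have "p x (y + z) \<bullet> (y + z) = p x y \<bullet> z + p x z \<bullet> y"
    by (simp add: p_add_right inner_add_left inner_add_right right)
  then have "p x y \<bullet> z + p x z \<bullet> y = 0" using right by simp
  then show ?thesis by (simp add: inner_commute)
qed

text \<open>
  Polarisation of the formula for the norm of \<open>p x y\<close> in \<open>y\<close>.
\<close>

lemma p_inner_p: "p x y \<bullet> p x z = (x \<bullet> x) * (y \<bullet> z) - (x \<bullet> y) * (x \<bullet> z)"
proof -
  have sq: "p x y \<bullet> p x y = (x \<bullet> x) * (y \<bullet> y) - (x \<bullet> y)\<^sup>2" for y
    using p_orthogonal_left_and_norm by blast
  have "2 * (p x y \<bullet> p x z) = p x (y + z) \<bullet> p x (y + z) - p x y \<bullet> p x y - p x z \<bullet> p x z"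
    by (simp add: p_add_right inner_add_left inner_add_right inner_commute)
  also have "\<dots> = 2 * ((x \<bullet> x) * (y \<bullet> z) - (x \<bullet> y) * (x \<bullet> z))"
    unfolding sq by (simp add: inner_add_left inner_add_right inner_commute power2_eq_square algebra_simps)
  finally show ?thesis by simp
qed

text \<open>
  Left multiplication \<open>L\<close> by \<open>x\<close> is skew-symmetric, so \<open>L (L y) \<bullet> z = - (L y \<bullet> L z)\<close>, and the right
  hand side is known for every \<open>z\<close>.
\<close>

lemma p_p_self: "p x (p x y) = (x \<bullet> y) *\<^sub>R x - (x \<bullet> x) *\<^sub>R y"
proof -
  have "p x (p x y) \<bullet> z = ((x \<bullet> y) *\<^sub>R x - (x \<bullet> x) *\<^sub>R y) \<bullet> z" for z
    using p_inner_p[of x y z] by (simp add: p_skew[of x "p x y"] inner_diff_left)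
  then show ?thesis by (metis vector_eq_rdot)
qed

text \<open>
  Polarisation of the formula for \<open>p x (p x z)\<close> in \<open>x\<close>: left multiplications by orthogonal vectors
  anticommute on vectors orthogonal to both.
\<close>

lemma p_p_swap:
  assumes "x \<bullet> y = 0" "x \<bullet> z = 0" "y \<bullet> z = 0"
  shows "p y (p x z) = - p x (p y z)"
proof -
  have "p (x + y) (p (x + y) z) = p x (p x z) + p y (p y z) + (p x (p y z) + p y (p x z))"
    by (simp add: p_add_left p_add_right)
  then have "p x (p y z) + p y (p x z) = 0"
    by (simp add: p_p_self inner_add_left inner_add_right assms inner_commute[of y x] algebra_simps)
  then show ?thesis by (simp add: eq_neg_iff_add_eq_0 add.commute)
qed

lemma Cayley_inner:
  assumes "Cayley_triple p (u, v, z)"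
  shows "u \<bullet> u = 1" "v \<bullet> v = 1" "z \<bullet> z = 1" "p u v \<bullet> p u v = 1"
    "u \<bullet> v = 0" "u \<bullet> p u v = 0" "v \<bullet> p u v = 0" "u \<bullet> z = 0" "v \<bullet> z = 0" "p u v \<bullet> z = 0"
  using assms orthonormal_snoc[of "[u, v, p u v]" z]
  by (simp_all add: Cayley_triple_def orthonormal_triple orthonormal_pair)

text \<open>
  The product of two different vectors of the Cayley basis is, up to sign, again a member of the
  basis, and which one and which sign do not depend on the triple. This is the reason why any two
  Cayley triples are related by an automorphism. Only one order of each pair of factors is listed;
  the products of two different vectors among \<open>u, v, z\<close> and of \<open>p u v\<close> with \<open>z\<close> are basis vectors
  by definition.
\<close>

lemma Cayley_table:
  assumes "Cayley_triple p (u, v, z)"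
  shows
    "p u (p u v) = - v" "p v (p u v) = u"
    "p u (p u z) = - z" "p u (p v z) = - p (p u v) z" "p u (p (p u v) z) = p v z"
    "p v (p u z) = p (p u v) z" "p v (p v z) = - z" "p v (p (p u v) z) = - p u z"
    "p (p u v) (p u z) = - p v z" "p (p u v) (p v z) = p u z" "p (p u v) (p (p u v) z) = - z"
    "p z (p u z) = u" "p z (p v z) = v" "p z (p (p u v) z) = p u v"
    "p (p u z) (p v z) = - p u v" "p (p u z) (p (p u v) z) = v" "p (p v z) (p (p u v) z) = - u"
proof -
  note inner = Cayley_inner[OF assms]
  have inner': "v \<bullet> u = 0" "p u v \<bullet> u = 0" "p u v \<bullet> v = 0" "z \<bullet> u = 0" "z \<bullet> v = 0" "z \<bullet> p u v = 0"
    using inner by (simp_all add: inner_commute)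
  let ?w = "p u v"
  show uw: "p u ?w = - v" by (simp add: p_p_self inner)
  show vw: "p v ?w = u"
    using p_p_self[of v u] by (simp add: p_anticommute[of v u] p_minus_right inner inner')
  show "p u (p u z) = - z" "p v (p v z) = - z" "p ?w (p ?w z) = - z"
    by (simp_all add: p_p_self inner)
  have z_left: "p z (p x z) = x" if "z \<bullet> x = 0" for x
    using p_p_self[of z x] that by (simp add: p_anticommute[of x z] p_minus_right inner)
  show "p z (p u z) = u" "p z (p v z) = v" "p z (p ?w z) = ?w"
    by (rule z_left; simp add: inner')+
  \<comment> \<open>Exchanging factors brings \<open>z\<close> to the front, at the price of a sign in each step.\<close>
  have assoc: "p x (p y z) = - p (p x y) z"
    if "x \<bullet> y = 0" "x \<bullet> z = 0" "y \<bullet> z = 0" for x y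
  proof -
    have "p x (p y z) = - p x (p z y)" by (simp add: p_anticommute[of y z] p_minus_right)
    also have "\<dots> = p z (p x y)"
      using p_p_swap[of x z y] that by (simp add: inner_commute)
    also have "\<dots> = - p (p x y) z" by (rule p_anticommute)
    finally show ?thesis .
  qed
  show "p u (p v z) = - p ?w z" "p v (p u z) = p ?w z" "p u (p ?w z) = p v z"
    "p v (p ?w z) = - p u z" "p ?w (p u z) = - p v z" "p ?w (p v z) = p u z"
    using assoc[of u v] assoc[of v u] assoc[of u ?w] assoc[of v ?w] assoc[of ?w u] assoc[of ?w v]
    by (simp_all add: inner inner' uw vw p_anticommute[of v u] p_anticommute[of ?w u]
        p_anticommute[of ?w v] p_minus_left)
  \<comment> \<open>Swapping the left multiplications by \<open>p x z\<close> and \<open>y\<close> produces \<open>p (p x z) z = - x\<close>.\<close>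
  have double: "p (p x z) (p y z) = - p x y"
    if "x \<bullet> y = 0" "x \<bullet> z = 0" "y \<bullet> z = 0" "p x y \<bullet> z = 0" for x y
  proof -
    have "p x z \<bullet> y = 0"
      using that(4) p_skew[of x z y] by (simp add: inner_commute)
    moreover have "p x z \<bullet> z = 0"
      using p_orthogonal_left[of z x] by (simp add: p_anticommute[of x z])
    ultimately have "p (p x z) (p y z) = - p y (p (p x z) z)"
      using p_p_swap[of y "p x z" z] that by (simp add: inner_commute)
    also have "p (p x z) z = - x"
      using z_left[of x] that by (simp add: p_anticommute[of "p x z" z] inner_commute)
    finally show ?thesis by (simp add: p_minus_right p_anticommute[of y x])
  qed
  show "p (p u z) (p v z) = - ?w" "p (p u z) (p ?w z) = v" "p (p v z) (p ?w z) = - u"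
    using double[of u v] double[of u ?w] double[of v ?w] by (simp_all add: inner inner' uw vw)
qed

section \<open>Transitivity on Cayley triples\<close>

text \<open>
  Let \<open>w = p u v\<close>. The span \<open>H\<close> of \<open>u, v, w\<close> is closed under the product and orthogonal to \<open>z\<close>. The
  last three vectors of the basis are the products \<open>p x z\<close> with \<open>x\<close> in \<open>{u, v, w}\<close>. They are orthogonal to \<open>H\<close> because skew-symmetry moves \<open>p x z \<bullet> y\<close> to \<open>z \<bullet> p x y\<close>, and right
  multiplication by \<open>z\<close> is an isometry on \<open>H\<close>.
\<close>

lemma Cayley_basis_frame:
  assumes "Cayley_triple p t"
  shows "orthonormal_frame (Cayley_basis p t)"
proof -
  obtain u v z where t: "t = (u, v, z)" by (cases t)
  note inner = Cayley_inner[OF assms[unfolded t]]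
  let ?w = "p u v"
  have inner': "v \<bullet> u = 0" "?w \<bullet> u = 0" "?w \<bullet> v = 0" "z \<bullet> u = 0" "z \<bullet> v = 0" "z \<bullet> ?w = 0"
    using inner by (simp_all add: inner_commute)
  have products: "p u ?w = - v" "p v ?w = u" "p v u = - ?w" "p ?w u = v" "p ?w v = - u"
    using Cayley_table(1,2)[OF assms[unfolded t]]
    by (simp_all add: p_anticommute[of v u] p_anticommute[of ?w u] p_anticommute[of ?w v])
  have "p x z \<bullet> y = - (z \<bullet> p x y)" "y \<bullet> p x z = - (z \<bullet> p x y)" for x y
    using p_skew[of x z y] by (simp_all add: inner_commute)
  then have mixed: "p x z \<bullet> y = 0" "y \<bullet> p x z = 0" if "x \<in> {u, v, ?w}" "y \<in> {u, v, ?w}" for x y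
    using that by (auto simp: products inner inner')
  have right: "p x z \<bullet> p y z = x \<bullet> y - (z \<bullet> x) * (z \<bullet> y)" for x y
    using p_inner_p[of z x y] by (simp add: p_anticommute[of _ z] inner)
  have last: "p x z \<bullet> z = 0" "z \<bullet> p x z = 0" for x
    using p_orthogonal_left[of z x] by (simp_all add: p_anticommute[of _ z] inner_commute)
  show ?thesis
    unfolding orthonormal_frame_def forall_7 t Cayley_basis_def prod.case vector_7
    by (simp add: inner inner' mixed right last)
qed

lemma range_Cayley_basis:
  "range (($) (Cayley_basis p (u, v, z))) = {u, v, p u v, z, p u z, p v z, p (p u v) z}"
  by (simp add: UNIV_7 Cayley_basis_def vector_7)

text \<open>
  The linear map that sends one Cayley basis to the other is orthogonal because both bases are
  orthonormal, and it preserves the product because both bases have the same multiplication table: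
  two bilinear maps that agree on a basis are equal.
\<close>

lemma G2_transitive:
  assumes dim: "DIM('a) = 7" and s: "Cayley_triple p s" and t: "Cayley_triple p t"
  obtains g where "g \<in> G2 p" "\<And>i. g (Cayley_basis p s $ i) = Cayley_basis p t $ i"
proof -
  let ?b = "Cayley_basis p s" and ?c = "Cayley_basis p t"
  note b = Cayley_basis_frame[OF s] and c = Cayley_basis_frame[OF t]
  have dim': "CARD(7) = DIM('a)" using dim by simp
  define g where "g x = (\<Sum>i\<in>UNIV. (x \<bullet> ?b $ i) *\<^sub>R ?c $ i)" for x
  have lin: "linear g"
    by (intro linearI)
      (simp_all add: g_def inner_add_left scaleR_add_left sum.distrib scaleR_sum_right)
  have gb: "g (?b $ i) = ?c $ i" for i
    by (rule orthonormal_frame_eqI[OF c dim'])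
      (simp add: g_def orthonormal_frame_combination_inner[OF c] orthonormal_frameD[OF b]
        orthonormal_frameD[OF c])
  have "g x \<bullet> g y = x \<bullet> y" for x y
  proof -
    have "g x \<bullet> g y = (\<Sum>i\<in>UNIV. (y \<bullet> ?b $ i) * (g x \<bullet> ?c $ i))"
      by (simp add: g_def[of y] inner_sum_right)
    also have "\<dots> = (\<Sum>i\<in>UNIV. (y \<bullet> ?b $ i) * (x \<bullet> ?b $ i))"
      by (simp add: g_def orthonormal_frame_combination_inner[OF c])
    also have "\<dots> = x \<bullet> (\<Sum>i\<in>UNIV. (y \<bullet> ?b $ i) *\<^sub>R ?b $ i)"
      by (simp add: inner_sum_right)
    finally show ?thesis by (simp add: orthonormal_frame_expansion[OF b dim'])
  qed
  then have orth: "orthogonal_transformation g"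
    using lin by (simp add: orthogonal_transformation_def)
  obtain u v z where st: "s = (u, v, z)" by (cases s)
  obtain u' v' z' where tt: "t = (u', v', z')" by (cases t)
  have g: "g u = u'" "g v = v'" "g (p u v) = p u' v'" "g z = z'" "g (p u z) = p u' z'"
    "g (p v z) = p v' z'" "g (p (p u v) z) = p (p u' v') z'"
    using gb[of 1] gb[of 2] gb[of 3] gb[of 4] gb[of 5] gb[of 6] gb[of 7]
    by (simp_all only: st tt Cayley_basis_def prod.case vector_7)
  have flip: "p y x = - w" if "p x y = w" for x y w
    using that p_anticommute[of y x] by simp
  note T = Cayley_table[OF s[unfolded st]] and T' = Cayley_table[OF t[unfolded tt]]
  note products = T T' T[THEN flip] T'[THEN flip]
    p_anticommute[of v u] p_anticommute[of z u] p_anticommute[of z v] p_anticommute[of z "p u v"]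
    p_anticommute[of v' u'] p_anticommute[of z' u'] p_anticommute[of z' v']
    p_anticommute[of z' "p u' v'"]
  have "\<forall>x\<in>range (($) ?b). \<forall>y\<in>range (($) ?b). g (p x y) = p (g x) (g y)"
    unfolding st range_Cayley_basis by (simp add: products g linear_neg[OF lin] linear_0[OF lin])
  moreover have "bilinear (\<lambda>x y. g (p x y))" "bilinear (\<lambda>x y. p (g x) (g y))"
    by (auto simp: bilinear_def linear_iff p_add_left p_add_right p_scale_left p_scale_right
        linear_add[OF lin] linear_scale[OF lin])
  ultimately have "g (p x y) = p (g x) (g y)" for x y
    using bilinear_eq[of "\<lambda>x y. g (p x y)" "\<lambda>x y. p (g x) (g y)" UNIV "range (($) ?b)"
        UNIV "range (($) ?b)" x y] orthonormal_frame_span[OF b dim'] by blast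
  then have "g \<in> G2 p" using orth by (simp add: G2_def)
  then show ?thesis using that gb by blast
qed

lemma Cayley_triple_extend:
  assumes "DIM('a) = 7" and "orthonormal [u, v]"
  obtains z where "Cayley_triple p (u, v, z)"
proof -
  have "orthonormal [u, v, p u v]"
    using vector_product assms(2) by (simp add: vector_product_def)
  then obtain z where "orthonormal ([u, v, p u v] @ [z])"
    using orthonormal_extend[of "[u, v, p u v]"] assms(1) by auto
  then show ?thesis using that by (simp add: Cayley_triple_def)
qed

section \<open>Cross-sections that consist of one diagonal matrix\<close>

text \<open>
  An automorphism that takes the Cayley basis of \<open>s\<close> to an eigenbasis diagonalises the endomorphism.
\<close>

lemma diagonal_in_orbit:
  assumes dim: "DIM('a) = 7" and s: "Cayley_triple p s" and t: "Cayley_triple p t"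
    and eigen: "\<And>i. inv_into symmetric_endos (matrix_wrt (Cayley_basis p s)) A (Cayley_basis p t $ i)
      = d $ i *\<^sub>R Cayley_basis p t $ i"
  shows "diagonal d \<in> G2_orbit p s A"
proof -
  let ?b = "Cayley_basis p s"
  let ?e = "inv_into symmetric_endos (matrix_wrt ?b) A"
  obtain g where g: "g \<in> G2 p" "\<And>i. g (?b $ i) = Cayley_basis p t $ i"
    using G2_transitive[OF dim s t] by blast
  have orth: "orthogonal_transformation g" using g(1) by (simp add: G2_def)
  then have lin: "linear g" and inj: "inj g"
    by (simp_all add: orthogonal_transformation_linear orthogonal_transformation_inj)
  have "(inv g \<circ> ?e \<circ> g) (?b $ j) = d $ j *\<^sub>R ?b $ j" for j
  proof -
    have "?e (g (?b $ j)) = g (d $ j *\<^sub>R ?b $ j)"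
      by (simp add: g(2) eigen linear_scale[OF lin])
    then show ?thesis using inj by simp
  qed
  then have "matrix_wrt ?b (inv g \<circ> ?e \<circ> g) = diagonal d"
    by (simp add: vec_eq_iff matrix_wrt_inner[OF Cayley_basis_frame[OF s] dim] diagonal_def
        orthonormal_frameD[OF Cayley_basis_frame[OF s]] del: comp_apply)
  then have "G2_act p s A g = diagonal d" by (simp add: G2_act_def Let_def)
  then show ?thesis using g(1) unfolding G2_orbit_def by (metis image_eqI)
qed

text \<open>
  If all but the first two diagonal entries agree, only the first two vectors of the eigenbasis need
  to be chosen with care. The multiplicities provide an orthonormal pair of eigenvectors to the
  first two entries; any extension to a Cayley triple then gives an eigenbasis, since the remaining
  basis vectors are orthogonal to all eigenspaces but that of \<open>d $ 7\<close>. The eigenvalues \<open>d $ 1\<close>, \<open>d $ 2\<close> and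
  \<open>d $ 7\<close> may coincide.
\<close>

theorem cross_section_diagonal:
  fixes d :: "real ^ 7"
  assumes dim: "DIM('a) = 7" and s: "Cayley_triple p s"
    and tail: "\<And>i. i \<noteq> 1 \<Longrightarrow> i \<noteq> 2 \<Longrightarrow> d $ i = d $ 7"
  shows "cross_section p s (eigenpairs (diagonal d)) {diagonal d}"
proof -
  let ?b = "Cayley_basis p s"
  note frame = Cayley_basis_frame[OF s]
  have dim': "CARD(7) = DIM('a)" using dim by simp
  have "diagonal d \<in> G2_orbit p s A"
    if A: "transpose A = A" "eigenpairs A = eigenpairs (diagonal d)" for A
  proof -
    define e where "e = inv_into symmetric_endos (matrix_wrt ?b) A"
    note preimage = symmetric_endo_exists[OF frame dim A(1)]
    have e: "e \<in> symmetric_endos" and matrix_e: "matrix_wrt ?b e = A"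
      unfolding e_def using inv_into_into[OF preimage] f_inv_into_f[OF preimage] by auto
    then have lin: "linear e" by (simp add: symmetric_endos_def)
    have mult: "dim {y. e y = d $ i *\<^sub>R y} = card {j. d $ j = d $ i}" for i
    proof -
      have "(d $ i, card {j. d $ j = d $ i}) \<in> eigenpairs A"
        unfolding A(2) eigenpairs_diagonal by blast
      then have "dim (eigenspace A (d $ i)) = card {j. d $ j = d $ i}"
        by (auto simp: eigenpairs_def)
      then show ?thesis
        using dim_eigenspace_matrix_wrt[OF frame dim lin, of "d $ i"] by (simp add: matrix_e)
    qed
    \<comment> \<open>Equal entries give one eigenspace of dimension at least 2, different ones two orthogonal
      eigenspaces.\<close>
    obtain u v where uv: "orthonormal [u, v]" "e u = d $ 1 *\<^sub>R u" "e v = d $ 2 *\<^sub>R v"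
    proof (cases "d $ 1 = d $ 2")
      case True
      obtain xs where xs: "orthonormal xs" "set xs \<subseteq> {y. e y = d $ 1 *\<^sub>R y}"
        "length xs = dim {y. e y = d $ 1 *\<^sub>R y}"
        using orthonormal_in_subspace[OF subspace_eigenvectors[OF lin]] by metis
      have "{1, 2} \<subseteq> {j. d $ j = d $ 1}" using True by simp
      then have "card {1, 2 :: 7} \<le> length xs"
        unfolding xs(3) mult by (intro card_mono) auto
      then have "2 \<le> length xs" by simp
      then have len: "0 < length xs" "1 < length xs" by linarith+
      have "orthonormal [xs ! 0, xs ! 1]"
        using xs(1) len unfolding orthonormal_pair by (simp add: orthonormal_def)
      moreover have "e (xs ! i) = d $ 1 *\<^sub>R xs ! i" if "i < length xs" for i
        using xs(2) nth_mem[OF that] by blast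
      ultimately show ?thesis using that len True by metis
    next
      case False
      have "\<exists>x. x \<bullet> x = 1 \<and> e x = d $ i *\<^sub>R x" for i
      proof -
        obtain xs where xs: "orthonormal xs" "set xs \<subseteq> {y. e y = d $ i *\<^sub>R y}"
          "length xs = dim {y. e y = d $ i *\<^sub>R y}"
          using orthonormal_in_subspace[OF subspace_eigenvectors[OF lin]] by metis
        have "0 < length xs" unfolding xs(3) mult by (auto simp: card_gt_0_iff)
        then have "xs ! 0 \<bullet> xs ! 0 = 1" "xs ! 0 \<in> set xs"
          using xs(1) by (auto simp: orthonormal_def)
        then show ?thesis using xs(2) by blast
      qed
      then obtain u v where "u \<bullet> u = 1" "e u = d $ 1 *\<^sub>R u" "v \<bullet> v = 1" "e v = d $ 2 *\<^sub>R v"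
        by metis
      then show ?thesis
        using that eigenvectors_orthogonal[OF e] False by (metis orthonormal_pair)
    qed
    obtain z where t: "Cayley_triple p (u, v, z)"
      using Cayley_triple_extend[OF dim uv(1)] .
    define b where "b = Cayley_basis p (u, v, z)"
    have b: "orthonormal_frame b" using Cayley_basis_frame[OF t] by (simp add: b_def)
    have b12: "b $ 1 = u" "b $ 2 = v" by (simp_all only: b_def Cayley_basis_def prod.case vector_7)
    have other: "e (b $ i) = d $ i *\<^sub>R b $ i" if "d $ i \<noteq> d $ 7" for i
      using that tail[of i] uv b12 by metis
    \<comment> \<open>If \<open>d $ 1\<close> or \<open>d $ 2\<close> equals \<open>d $ 7\<close>, that basis vector is left out of \<open>?I\<close> and counts for \<open>d $ 7\<close>.\<close>
    have "e (b $ i) = d $ i *\<^sub>R b $ i" for i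
    proof (cases "d $ i = d $ 7")
      case True
      let ?I = "{i. d $ i \<noteq> d $ 7}"
      have "independent (($) b ` ?I)"
        using orthonormal_frame_independent[OF b] by (rule independent_mono) auto
      moreover have "card (($) b ` ?I) + dim {y. e y = d $ 7 *\<^sub>R y} = DIM('a)"
      proof -
        have "card (($) b ` ?I) = card ?I"
          using orthonormal_frame_inj[OF b] by (intro card_image) (rule inj_on_subset, auto)
        moreover have "card ?I + card {i. d $ i = d $ 7} = card (?I \<union> {i. d $ i = d $ 7})"
          by (intro card_Un_disjoint[symmetric]) auto
        moreover have "?I \<union> {i. d $ i = d $ 7} = UNIV" by auto
        ultimately show ?thesis using dim' by (simp add: mult)
      qed
      moreover have "x \<bullet> b $ i = 0" if "x \<in> ($) b ` ?I" for x
        using that True by (auto simp: orthonormal_frameD[OF b])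
      ultimately have "e (b $ i) = d $ 7 *\<^sub>R b $ i"
        using other by (intro orthogonal_to_other_eigenvectors[OF e, of "($) b ` ?I"]) auto
      then show ?thesis using True by simp
    next
      case False
      then show ?thesis by (rule other)
    qed
    then show ?thesis
      using diagonal_in_orbit[OF dim s t] by (simp add: b_def e_def)
  qed
  moreover have "transpose (diagonal d) = diagonal d"
    by (auto simp: diagonal_def transpose_def vec_eq_iff)
  ultimately show ?thesis by (auto simp: cross_section_def Sym_def)
qed

end

lemma block_diag_eq_diagonal:
  "block_diag bs = diagonal (vector (concat (map (\<lambda>(c, n). replicate n c) bs)))"
  by (simp add: block_diag_def diagonal_def)

theorem proposition3p1:
  fixes p :: "'a::euclidean_space \<Rightarrow> 'a \<Rightarrow> 'a"
    and s :: "'a \<times> 'a \<times> 'a"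
    and l m n :: real
  assumes "DIM('a) = 7"
    and "vector_product p"
    and "Cayley_triple p s"
    and "l \<noteq> m" and "l \<noteq> n" and "m \<noteq> n"
  shows "cross_section p s {(l, 7)} {l *\<^sub>R mat 1} \<and>
    cross_section p s {(l, 1), (m, 6)} {block_diag [(l, 1), (m, 6)]} \<and>
    cross_section p s {(l, 2), (m, 5)} {block_diag [(l, 2), (m, 5)]} \<and>
    cross_section p s {(l, 1), (m, 1), (n, 5)} {block_diag [(l, 1), (m, 1), (n, 5)]}"
proof -
  have singleton: "cross_section p s P {M}"
    if "P = eigenpairs (diagonal d)" "M = diagonal d"
      "\<And>i. i \<noteq> 1 \<Longrightarrow> i \<noteq> 2 \<Longrightarrow> d $ i = d $ 7" for P M d
    using cross_section_diagonal[OF assms(2,1,3) that(3)] that(1,2) by simp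
  have tail: "vector [a, b, c, c, c, c, c] $ i = (vector [a, b, c, c, c, c, c] :: real ^ 7) $ 7"
    if "i \<noteq> 1" "i \<noteq> 2" for a b c :: real and i :: 7
    using exhaust_7[of i] that by (auto simp only: vector_7)
  \<comment> \<open>One formula for all coincidences among \<open>a, b, c\<close>; coinciding pairs collapse in the set.\<close>
  have pairs: "eigenpairs (diagonal (vector [a, b, c, c, c, c, c] :: real ^ 7)) =
    {(a, 1 + of_bool (b = a) + 5 * of_bool (c = a)),
     (b, 1 + of_bool (a = b) + 5 * of_bool (c = b)),
     (c, 5 + of_bool (a = c) + of_bool (b = c))}" for a b c :: real
    unfolding eigenpairs_diagonal UNIV_7 image_insert image_empty card_7 vector_7
    by (simp add: insert_commute eval_nat_numeral)
  have "cross_section p s {(l, 7)} {l *\<^sub>R mat 1}"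
    by (rule singleton[where d = "vector [l, l, l, l, l, l, l]", OF _ _ tail], unfold pairs)
      (simp_all add: vec_eq_iff diagonal_def mat_def forall_7 vector_7)
  moreover have "cross_section p s {(l, 1), (m, 6)} {block_diag [(l, 1), (m, 6)]}"
    by (rule singleton[where d = "vector [l, m, m, m, m, m, m]", OF _ _ tail], unfold pairs)
      (use assms(4) in \<open>simp_all add: block_diag_eq_diagonal eval_nat_numeral\<close>)
  moreover have "cross_section p s {(l, 2), (m, 5)} {block_diag [(l, 2), (m, 5)]}"
    by (rule singleton[where d = "vector [l, l, m, m, m, m, m]", OF _ _ tail], unfold pairs)
      (use assms(4) in \<open>simp_all add: block_diag_eq_diagonal eval_nat_numeral\<close>)
  moreover have "cross_section p s {(l, 1), (m, 1), (n, 5)} {block_diag [(l, 1), (m, 1), (n, 5)]}"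
    by (rule singleton[where d = "vector [l, m, n, n, n, n, n]", OF _ _ tail], unfold pairs)
      (use assms(4-6) in \<open>simp_all add: block_diag_eq_diagonal eval_nat_numeral\<close>)
  ultimately show ?thesis by blast
qed

end
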